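(* Let $n\geqslant1$. Then, for every $a>0$ with $a\neq1$, the inequality $$\frac{\gamma_n\bigl((1-t)aB_n+tB_n\bigr)}{\mathrm{S}^{\gamma_n}\bigl((1-t)aB_n+tB_n\bigr)}\geqslant(1-t)\,\frac{\gamma_n(aB_n)}{\mathrm{S}^{\gamma_n}(aB_n)}+t\,\frac{\gamma_n(B_n)}{\mathrm{S}^{\gamma_n}(B_n)}$$ does not hold for any $t\in(0,1)$. In fact, for every $t\in(0,1)$ the reverse strict inequality (with $<$ in place of $\geqslant$) holds.
   Context: $B_n$ is the closed Euclidean unit ball of $\mathbb{R}^n$ and $+$ is the Minkowski addition. $\gamma_n$ is the standard Gaussian measure on $\mathbb{R}^n$, $d\gamma_n(x)=(2\pi)^{-n/2}e^{-\|x\|^2/2}\,dx$. For a closed convex set $K\subset\mathbb{R}^n$, its Gaussian surface area is $\mathrm{S}^{\gamma_n}(K)=\lim_{\varepsilon\to0^+}\frac{\gamma_n(K+\varepsilon B_n)-\gamma_n(K)}{\varepsilon}$, whenever this limit exists. *)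

theory Defs
  imports "HOL-Analysis.Analysis" "HOL-Library.Set_Algebras"
begin

definition gaussian_measure :: "(real ^ 'n) measure" where
  "gaussian_measure =
     density lborel (\<lambda>x. ennreal ((2 * pi) powr (- real CARD('n) / 2) * exp (- (norm x)\<^sup>2 / 2)))"

abbreviation unit_ball :: "(real ^ 'n) set" where
  "unit_ball \<equiv> cball 0 1"

abbreviation dilate :: "real \<Rightarrow> (real ^ 'n) set \<Rightarrow> (real ^ 'n) set" where
  "dilate c A \<equiv> (\<lambda>x. c *\<^sub>R x) ` A"

(* The sum of sets is the Minkowski sum of HOL-Library.Set_Algebras. The value is
   meaningful only where the limit exists, since Lim is unspecified otherwise. *)
definition gaussian_surface_area :: "(real ^ 'n) set \<Rightarrow> real" where
  "gaussian_surface_area K =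
     Lim (at_right 0)
       (\<lambda>\<epsilon>. (measure gaussian_measure (K + dilate \<epsilon> unit_ball) - measure gaussian_measure K) / \<epsilon>)"

abbreviation gaussian_ratio :: "(real ^ 'n) set \<Rightarrow> real" where
  "gaussian_ratio K \<equiv> measure gaussian_measure K / gaussian_surface_area K"

end

theory Submission
  imports Defs
begin

text \<open>
  By homogeneity, a sandwich of the density on thin shells gives
  S(r B) = c n v r^(n-1) exp(-r^2/2), where v is the volume of B and c the normalising constant of
  the density. Rescaling the integral over r B to the unit ball then shows
  gamma(r B) / S(r B) = 1/(n v) * (integral over x in B of r exp(r^2 (1 - |x|^2) / 2)),
  and for |x| < 1 the integrand is a strictly convex function of r > 0.
\<close>

section \<open>Centred balls and integrals over them\<close>

lemma cball_plus_cball: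
  fixes r s :: real
  assumes "0 \<le> r" "0 \<le> s"
  shows "cball (0::'a::real_normed_vector) r + cball 0 s = cball 0 (r + s)"
proof
  show "cball (0::'a) r + cball 0 s \<subseteq> cball 0 (r + s)"
    by (auto elim!: set_plus_elim intro!: norm_triangle_le add_mono)
next
  show "cball (0::'a) (r + s) \<subseteq> cball 0 r + cball 0 s"
  proof
    fix x :: 'a
    assume "x \<in> cball 0 (r + s)"
    then have x: "norm x \<le> r + s" by simp
    show "x \<in> cball 0 r + cball 0 s"
    proof (cases "r + s = 0")
      case True
      with x assms show ?thesis using set_plus_intro[of 0 "cball (0::'a) r" 0 "cball 0 s"] by simp
    next
      case False
      with assms have pos: "r + s > 0" by linarith
      \<comment> \<open>Splitting \<open>x\<close> in proportion to the two radii gives pieces of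
        norm at most \<open>r\<close> and \<open>s\<close>. The division is why
        \<open>r + s = 0\<close> is a separate case.\<close>
      have "x = (r / (r + s)) *\<^sub>R x + (s / (r + s)) *\<^sub>R x"
        using pos by (simp flip: scaleR_left_distrib add_divide_distrib)
      moreover have "norm ((q / (r + s)) *\<^sub>R x) \<le> q" if "0 \<le> q" for q
        using mult_left_mono[OF x, of "q / (r + s)"] that pos by simp
      ultimately show ?thesis
        using assms by (metis mem_cball_0 set_plus_intro)
    qed
  qed
qed

lemma dilate_unit_ball: "0 \<le> r \<Longrightarrow> dilate r (unit_ball :: (real ^ 'n) set) = cball 0 r"
  by (cases "r = 0") (auto simp: cball_scale image_constant_conv)

text \<open>The nonnegative difference \<open>g - f\<close> has integral zero only if it vanishes
  almost everywhere, which the non-null set \<open>B\<close> prevents. Strictness is asked only on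
  \<open>B\<close> because the convexity used later degenerates on the unit sphere.\<close>

lemma set_integral_less:
  fixes f g :: "'a \<Rightarrow> real"
  assumes f: "set_integrable M A f" and g: "set_integrable M A g"
    and B: "B \<in> sets M" "B \<subseteq> A" "emeasure M B \<noteq> 0"
    and le: "\<And>x. x \<in> A \<Longrightarrow> f x \<le> g x" and less: "\<And>x. x \<in> B \<Longrightarrow> f x < g x"
  shows "(LINT x:A|M. f x) < (LINT x:A|M. g x)"
proof -
  let ?h = "\<lambda>x. indicator A x *\<^sub>R (g x - f x)"
  have h: "integrable M ?h"
    using set_integral_diff(1)[OF g f] by (simp add: set_integrable_def)
  have nn: "AE x in M. 0 \<le> ?h x" using le by (auto simp: indicator_def)
  have "integral\<^sup>L M ?h \<noteq> 0"
  proof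
    assume "integral\<^sup>L M ?h = 0"
    then have "AE x in M. ?h x = 0" using integral_nonneg_eq_0_iff_AE[OF h nn] by simp
    then have "AE x in M. x \<notin> B"
      by eventually_elim (use B less in \<open>force simp: indicator_def\<close>)
    then show False using B by (simp add: AE_iff_measurable[OF _ refl] Int_absorb1 sets.sets_into_space
        flip: Int_def)
  qed
  moreover have "0 \<le> integral\<^sup>L M ?h" by (rule integral_nonneg_AE[OF nn])
  moreover have "integral\<^sup>L M ?h = (LINT x:A|M. g x) - (LINT x:A|M. f x)"
    using set_integral_diff(2)[OF g f] by (simp add: set_lebesgue_integral_def)
  ultimately show ?thesis by linarith
qed

lemma set_integrable_continuous_compact:
  fixes f :: "'a::euclidean_space \<Rightarrow> real"
  assumes "compact A" "continuous_on A f"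
  shows "set_integrable lborel A f"
  using borel_integrable_compact[OF assms] by (simp add: set_integrable_def)

text \<open>Change of variables by the dilation with factor \<open>r\<close>, whose Jacobian is
  \<open>r ^ DIM('a)\<close>. It moves all radii onto one fixed domain, so that integrals for
  different radii can be compared pointwise.\<close>

lemma set_integral_cball_scale:
  fixes f :: "'a::euclidean_space \<Rightarrow> real"
  assumes "r > 0" and [measurable]: "f \<in> borel_measurable borel"
  shows "(LINT x:cball 0 r|lborel. f x) = r ^ DIM('a) * (LINT x:cball 0 1|lborel. f (r *\<^sub>R x))"
proof -
  have meas: "(\<lambda>x. indicator (cball 0 r) x * f x) \<in> borel_measurable borel"
    using assms(2) by (intro borel_measurable_times borel_measurable_indicator) auto
  have "(LINT x:cball 0 r|lborel. f x)
      = (\<integral>x. indicator (cball 0 r) x *\<^sub>R f x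
          \<partial>density (distr lborel borel (\<lambda>x::'a. 0 + r *\<^sub>R x)) (\<lambda>_. ennreal (\<bar>r\<bar> ^ DIM('a))))"
    using assms by (subst lborel_affine[of r 0, symmetric]) (simp_all add: set_lebesgue_integral_def)
  also have "\<dots> = r ^ DIM('a) * (\<integral>x. indicator (cball 0 r) (r *\<^sub>R x) *\<^sub>R f (r *\<^sub>R x) \<partial>lborel)"
    using assms meas by (subst integral_density) (simp_all add: integral_distr)
  also have "(\<lambda>x. indicator (cball 0 r) (r *\<^sub>R x) :: real) = (\<lambda>x::'a. indicator (cball 0 1) x)"
    using assms by (auto simp: indicator_def)
  finally show ?thesis by (simp add: set_lebesgue_integral_def)
qed

section \<open>Gaussian measure and surface area of centred balls\<close>

definition gauss_const :: "'n itself \<Rightarrow> real" where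
  "gauss_const _ = (2 * pi) powr (- real CARD('n) / 2)"

lemma gauss_const_pos: "gauss_const TYPE('n) > 0"
  by (simp add: gauss_const_def)

text \<open>Compactness makes the continuous density integrable on \<open>K\<close>, so the extended
  nonnegative integral behind the measure is a finite real integral.\<close>

lemma measure_gaussian:
  assumes "compact (K :: (real ^ 'n) set)"
  shows "measure gaussian_measure K
    = gauss_const TYPE('n) * (LINT x:K|lborel. exp (- (norm x)\<^sup>2 / 2))"
proof -
  have K: "K \<in> sets borel" using assms by (simp add: borel_compact)
  have "emeasure gaussian_measure K
      = (\<integral>\<^sup>+x. ennreal (indicator K x * (gauss_const TYPE('n) * exp (- (norm x)\<^sup>2 / 2))) \<partial>lborel)"
    using K unfolding gaussian_measure_def
    by (subst emeasure_density) (auto simp: gauss_const_def indicator_def intro!: nn_integral_cong)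
  moreover have "integrable lborel
      (\<lambda>x. indicator K x * (gauss_const TYPE('n) * exp (- (norm x)\<^sup>2 / 2)))"
    using borel_integrable_compact[OF assms, of "\<lambda>x. gauss_const TYPE('n) * exp (- (norm x)\<^sup>2 / 2)"]
    by (force intro: continuous_intros)
  ultimately have "emeasure gaussian_measure K
      = ennreal (\<integral>x. indicator K x * (gauss_const TYPE('n) * exp (- (norm x)\<^sup>2 / 2)) \<partial>lborel)"
    using gauss_const_pos[where 'n='n]
    by (simp only: nn_integral_eq_integral[OF _ AE_I2] less_imp_le indicator_pos_le
        mult_nonneg_nonneg exp_ge_zero)
  then have "measure gaussian_measure K
      = (\<integral>x. indicator K x * (gauss_const TYPE('n) * exp (- (norm x)\<^sup>2 / 2)) \<partial>lborel)"
    using gauss_const_pos[where 'n='n]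
    by (simp add: measure_def integral_nonneg_AE)
  then show ?thesis
    by (simp add: set_lebesgue_integral_def mult.left_commute)
qed

text \<open>The density decreases with the norm, so on the shell between the radii \<open>r\<close>
  and \<open>s\<close> it lies between its values at \<open>s\<close> and at \<open>r\<close>. The
  factor multiplying the exponentials is the volume of the shell times the normalising
  constant.\<close>

lemma gaussian_shell_bounds:
  assumes "0 \<le> r" "r \<le> s"
  defines "\<kappa> \<equiv> gauss_const TYPE('n) * unit_ball_vol (real CARD('n))"
  defines "\<Delta> \<equiv> measure gaussian_measure (cball (0 :: real ^ 'n) s)
                - measure gaussian_measure (cball (0 :: real ^ 'n) r)"
  shows "\<kappa> * (s ^ CARD('n) - r ^ CARD('n)) * exp (- s\<^sup>2 / 2) \<le> \<Delta>"
    and "\<Delta> \<le> \<kappa> * (s ^ CARD('n) - r ^ CARD('n)) * exp (- r\<^sup>2 / 2)"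
proof -
  let ?e = "\<lambda>x::real^'n. exp (- (norm x)\<^sup>2 / 2)"
  let ?A = "cball (0 :: real ^ 'n) s - cball 0 r"
  have int: "set_integrable lborel (cball (0::real^'n) q) ?e" for q
    by (intro set_integrable_continuous_compact continuous_intros compact_cball) auto
  have intA: "set_integrable lborel ?A ?e"
    by (rule set_integrable_subset[OF int[of s]]) auto
  have un: "cball (0 :: real ^ 'n) s = ?A \<union> cball 0 r" using assms by auto
  have "(LINT x:cball (0::real^'n) s|lborel. ?e x)
      = (LINT x:?A|lborel. ?e x) + (LINT x:cball (0::real^'n) r|lborel. ?e x)"
    by (subst un, rule set_integral_Un[OF _ intA int]) auto
  then have \<Delta>: "\<Delta> = gauss_const TYPE('n) * (LINT x:?A|lborel. ?e x)"
    unfolding \<Delta>_def by (simp add: measure_gaussian right_diff_distrib[symmetric])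
  have fin: "emeasure lborel (cball (0::real^'n) q) \<noteq> \<infinity>" for q
    using emeasure_bounded_finite[of "cball (0::real^'n) q"] by auto
  have finA: "emeasure lborel ?A < \<infinity>"
    using emeasure_bounded_finite[of ?A] by (simp add: bounded_diff)
  have const: "set_integrable lborel ?A (\<lambda>_. c)" for c :: real
    using finA by (auto simp: set_integrable_def)
  \<comment> \<open>With \<open>c\<close> arbitrary, rewriting backwards turns either bound into the
    integral of a constant, to which monotonicity of the integral applies.\<close>
  have vol: "(LINT x:?A|lborel. c) = c * (unit_ball_vol (real CARD('n)) * (s ^ CARD('n) - r ^ CARD('n)))"
    for c :: real
  proof -
    have "measure lborel ?A = measure lborel (cball (0::real^'n) s) - measure lborel (cball (0::real^'n) r)"
      using assms fin by (subst measure_Diff) auto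
    also have "\<dots> = unit_ball_vol (real CARD('n)) * (s ^ CARD('n) - r ^ CARD('n))"
      using assms by (simp add: content_cball right_diff_distrib)
    finally show ?thesis
      using finA by (simp add: set_integral_const)
  qed
  have lo: "exp (- s\<^sup>2 / 2) \<le> ?e x" if "x \<in> ?A" for x
    using that by (auto intro: power_mono)
  have hi: "?e x \<le> exp (- r\<^sup>2 / 2)" if "x \<in> ?A" for x
    using that assms by (auto intro: power_mono)
  have "exp (- s\<^sup>2 / 2) * (unit_ball_vol (real CARD('n)) * (s ^ CARD('n) - r ^ CARD('n)))
      \<le> (LINT x:?A|lborel. ?e x)"
    unfolding vol[symmetric] by (rule set_integral_mono[OF const intA lo])
  from mult_left_mono[OF this, of "gauss_const TYPE('n)"]
  show "\<kappa> * (s ^ CARD('n) - r ^ CARD('n)) * exp (- s\<^sup>2 / 2) \<le> \<Delta>"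
    using gauss_const_pos[where 'n='n] unfolding \<Delta> \<kappa>_def by (simp add: mult_ac)
  have "(LINT x:?A|lborel. ?e x)
      \<le> exp (- r\<^sup>2 / 2) * (unit_ball_vol (real CARD('n)) * (s ^ CARD('n) - r ^ CARD('n)))"
    unfolding vol[symmetric] by (rule set_integral_mono[OF intA const hi])
  from mult_left_mono[OF this, of "gauss_const TYPE('n)"]
  show "\<Delta> \<le> \<kappa> * (s ^ CARD('n) - r ^ CARD('n)) * exp (- r\<^sup>2 / 2)"
    using gauss_const_pos[where 'n='n] unfolding \<Delta> \<kappa>_def by (simp add: mult_ac)
qed

text \<open>In the shell bounds with \<open>s = r + \<epsilon>\<close>, division by
  \<open>\<epsilon>\<close> leaves the difference quotient of the \<open>n\<close>-th power, which
  tends to its derivative at \<open>r\<close>, while the two exponential factors have the same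
  limit. Squeezing also proves that the limit defining the surface area exists.\<close>

lemma gaussian_surface_area_cball:
  assumes "r > 0"
  shows "gaussian_surface_area (cball (0 :: real ^ 'n) r)
    = gauss_const TYPE('n) * unit_ball_vol (real CARD('n))
        * (real CARD('n) * r ^ (CARD('n) - 1)) * exp (- r\<^sup>2 / 2)"
    (is "_ = ?S")
proof -
  let ?\<kappa> = "gauss_const TYPE('n) * unit_ball_vol (real CARD('n))"
  let ?G = "\<lambda>s. measure gaussian_measure (cball (0 :: real ^ 'n) s)"
  let ?p = "\<lambda>\<epsilon>. ((r + \<epsilon>) ^ CARD('n) - r ^ CARD('n)) / \<epsilon>"
  have "((\<lambda>s::real. s ^ CARD('n)) has_real_derivative real CARD('n) * r ^ (CARD('n) - 1)) (at r)"
    by (auto intro!: derivative_eq_intros)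
  then have "?p \<midarrow>0\<rightarrow> real CARD('n) * r ^ (CARD('n) - 1)"
    by (simp add: DERIV_def)
  then have p: "(?p \<longlongrightarrow> real CARD('n) * r ^ (CARD('n) - 1)) (at_right 0)"
    by (rule filterlim_mono) (auto simp: at_le)
  have "((\<lambda>\<epsilon>. exp (- (r + \<epsilon>)\<^sup>2 / 2)) \<longlongrightarrow> exp (- (r + 0)\<^sup>2 / 2)) (at_right 0)"
    by (intro tendsto_intros) auto
  then have lo: "((\<lambda>\<epsilon>. ?\<kappa> * ?p \<epsilon> * exp (- (r + \<epsilon>)\<^sup>2 / 2)) \<longlongrightarrow> ?S) (at_right 0)"
    by (intro tendsto_mult[OF tendsto_mult[OF tendsto_const p]]) simp
  have hi: "((\<lambda>\<epsilon>. ?\<kappa> * ?p \<epsilon> * exp (- r\<^sup>2 / 2)) \<longlongrightarrow> ?S) (at_right 0)"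
    by (intro tendsto_mult p tendsto_const)
  have pos: "\<forall>\<^sub>F \<epsilon> in at_right (0::real). 0 < \<epsilon>"
    by (auto simp: eventually_at_filter)
  have "((\<lambda>\<epsilon>. (?G (r + \<epsilon>) - ?G r) / \<epsilon>) \<longlongrightarrow> ?S) (at_right 0)"
  proof (rule tendsto_sandwich[OF _ _ lo hi])
    show "\<forall>\<^sub>F \<epsilon> in at_right 0. ?\<kappa> * ?p \<epsilon> * exp (- (r + \<epsilon>)\<^sup>2 / 2) \<le> (?G (r + \<epsilon>) - ?G r) / \<epsilon>"
      using pos
    proof eventually_elim
      case (elim \<epsilon>)
      with divide_right_mono[OF gaussian_shell_bounds(1)[of r "r + \<epsilon>", where 'n='n], of \<epsilon>] assms
      show ?case by simp
    qed
    show "\<forall>\<^sub>F \<epsilon> in at_right 0. (?G (r + \<epsilon>) - ?G r) / \<epsilon> \<le> ?\<kappa> * ?p \<epsilon> * exp (- r\<^sup>2 / 2)"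
      using pos
    proof eventually_elim
      case (elim \<epsilon>)
      with divide_right_mono[OF gaussian_shell_bounds(2)[of r "r + \<epsilon>", where 'n='n], of \<epsilon>] assms
      show ?case by simp
    qed
  qed
  moreover have "\<forall>\<^sub>F \<epsilon> in at_right 0. (?G (r + \<epsilon>) - ?G r) / \<epsilon>
      = (measure gaussian_measure (cball (0 :: real ^ 'n) r + dilate \<epsilon> unit_ball) - ?G r) / \<epsilon>"
    using pos
    by eventually_elim (use assms in \<open>simp add: dilate_unit_ball cball_plus_cball\<close>)
  ultimately have "((\<lambda>\<epsilon>. (measure gaussian_measure (cball (0 :: real ^ 'n) r + dilate \<epsilon> unit_ball)
      - ?G r) / \<epsilon>) \<longlongrightarrow> ?S) (at_right 0)"
    by (rule Lim_transform_eventually)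
  \<comment> \<open>Convergence is established, so \<open>Lim\<close> denotes this value and not an
    unspecified one; the remaining side condition is that \<open>at_right 0\<close> is
    nontrivial.\<close>
  then show ?thesis
    unfolding gaussian_surface_area_def by (intro tendsto_Lim) simp
qed

text \<open>The normalising constant cancels, the powers of \<open>r\<close> leave a single factor
  \<open>r\<close>, and the reciprocal of \<open>exp (- r\<^sup>2 / 2)\<close> moves into the
  integrand. There it makes the coefficient of \<open>r\<^sup>2\<close> in the exponent nonnegative
  on the whole unit ball.\<close>

lemma gaussian_ratio_cball:
  assumes "r > 0"
  shows "gaussian_ratio (cball (0 :: real ^ 'n) r)
    = (LINT x:cball (0 :: real ^ 'n) 1|lborel. r * exp ((1 - (norm x)\<^sup>2) / 2 * r\<^sup>2))
        / (unit_ball_vol (real CARD('n)) * real CARD('n))"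
proof -
  let ?I = "LINT x:cball (0 :: real ^ 'n) 1|lborel. exp (- (r * norm x)\<^sup>2 / 2)"
  have meas: "measure gaussian_measure (cball (0 :: real ^ 'n) r)
      = gauss_const TYPE('n) * (r ^ CARD('n) * ?I)"
    using set_integral_cball_scale[OF assms, of "\<lambda>x :: real ^ 'n. exp (- (norm x)\<^sup>2 / 2)"] assms
    by (simp add: measure_gaussian)
  have "(1 - (norm x)\<^sup>2) / 2 * r\<^sup>2 = r\<^sup>2 / 2 + - (r * norm x)\<^sup>2 / 2" for x :: "real ^ 'n"
    by (simp add: field_simps)
  then have "r * exp ((1 - (norm x)\<^sup>2) / 2 * r\<^sup>2) = (r * exp (r\<^sup>2 / 2)) * exp (- (r * norm x)\<^sup>2 / 2)"
    for x :: "real ^ 'n"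
    by (simp only: exp_add mult.assoc)
  note pointwise = this
  have I: "(LINT x:cball (0 :: real ^ 'n) 1|lborel. r * exp ((1 - (norm x)\<^sup>2) / 2 * r\<^sup>2))
      = r * exp (r\<^sup>2 / 2) * ?I"
    unfolding pointwise by simp
  \<comment> \<open>The dimension is positive, so the truncated subtraction
    \<open>CARD('n) - 1\<close> is the true predecessor.\<close>
  have "r ^ CARD('n) = r * r ^ (CARD('n) - 1)"
    by (metis power_minus_mult zero_less_card_finite mult.commute)
  then show ?thesis
    using assms gauss_const_pos[where 'n='n]
    unfolding I meas gaussian_surface_area_cball[OF assms]
    by (simp add: field_simps unit_ball_vol_pos[THEN order_less_imp_not_eq2] flip: exp_add)
qed

section \<open>Strict convexity of \<open>y * exp (c * y\<^sup>2)\<close> and of the ratio\<close>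

lemma mult_exp_square_tangent:
  fixes c r y :: real
  assumes "c \<ge> 0" "r > 0" "y > 0"
  shows "exp (c * r\<^sup>2) * (r + (1 + 2 * c * r\<^sup>2) * (y - r)) \<le> y * exp (c * y\<^sup>2)"
    and "c > 0 \<Longrightarrow> y \<noteq> r \<Longrightarrow>
      exp (c * r\<^sup>2) * (r + (1 + 2 * c * r\<^sup>2) * (y - r)) < y * exp (c * y\<^sup>2)"
proof -
  \<comment> \<open>Times \<open>exp (c * r\<^sup>2)\<close>, the left side is the tangent at
    \<open>r\<close> of \<open>y * exp (c * y\<^sup>2)\<close>. The subtracted remainder is
    nonnegative, and positive when \<open>c > 0\<close> and \<open>y \<noteq> r\<close>; this is the
    source of strictness.\<close>
  have eq: "r + (1 + 2 * c * r\<^sup>2) * (y - r)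
      = y * (1 + c * (y\<^sup>2 - r\<^sup>2)) - c * ((y - r)\<^sup>2 * (y + 2 * r))"
    by (simp add: algebra_simps power2_eq_square)
  \<comment> \<open>This is \<open>1 + z \<le> exp z\<close> at
    \<open>z = c * (y\<^sup>2 - r\<^sup>2)\<close>; multiplying by
    \<open>exp (c * r\<^sup>2)\<close> then restores the function value at \<open>y\<close>.\<close>
  have "y * (1 + c * (y\<^sup>2 - r\<^sup>2)) \<le> y * exp (c * (y\<^sup>2 - r\<^sup>2))"
    using assms by (intro mult_left_mono exp_ge_add_one_self) auto
  then have le: "exp (c * r\<^sup>2) * (y * (1 + c * (y\<^sup>2 - r\<^sup>2))) \<le> y * exp (c * y\<^sup>2)"
    using mult_left_mono[of _ _ "exp (c * r\<^sup>2)"]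
    by (fastforce simp: right_diff_distrib exp_diff)
  have "exp (c * r\<^sup>2) * (r + (1 + 2 * c * r\<^sup>2) * (y - r)) \<le> exp (c * r\<^sup>2) * (y * (1 + c * (y\<^sup>2 - r\<^sup>2)))"
    unfolding eq using assms by simp
  with le show "exp (c * r\<^sup>2) * (r + (1 + 2 * c * r\<^sup>2) * (y - r)) \<le> y * exp (c * y\<^sup>2)"
    by linarith
  assume "c > 0" "y \<noteq> r"
  then have "exp (c * r\<^sup>2) * (r + (1 + 2 * c * r\<^sup>2) * (y - r)) < exp (c * r\<^sup>2) * (y * (1 + c * (y\<^sup>2 - r\<^sup>2)))"
    unfolding eq using assms by simp
  with le show "exp (c * r\<^sup>2) * (r + (1 + 2 * c * r\<^sup>2) * (y - r)) < y * exp (c * y\<^sup>2)"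
    by linarith
qed

text \<open>The tangent \<open>?T\<close> at the intermediate point \<open>r\<close> lies below the
  function at \<open>a\<close> and at \<open>b\<close>. Being affine, it averages to its value at
  \<open>r\<close>, which is the function value there. For \<open>a \<noteq> b\<close> both
  endpoints differ from \<open>r\<close>, so both tangent inequalities are strict when
  \<open>c > 0\<close>.\<close>

lemma mult_exp_square_convex:
  fixes a b c t :: real
  assumes "c \<ge> 0" "a > 0" "b > 0" "0 < t" "t < 1"
  defines "r \<equiv> (1 - t) * a + t * b"
  shows "r * exp (c * r\<^sup>2) \<le> (1 - t) * (a * exp (c * a\<^sup>2)) + t * (b * exp (c * b\<^sup>2))"
    and "c > 0 \<Longrightarrow> a \<noteq> b \<Longrightarrow>
      r * exp (c * r\<^sup>2) < (1 - t) * (a * exp (c * a\<^sup>2)) + t * (b * exp (c * b\<^sup>2))"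
proof -
  let ?T = "\<lambda>y. exp (c * r\<^sup>2) * (r + (1 + 2 * c * r\<^sup>2) * (y - r))"
  have r: "r > 0" using assms by (simp add: add_pos_pos)
  have "(1 - t) * ?T a + t * ?T b
      = exp (c * r\<^sup>2) * (r + (1 + 2 * c * r\<^sup>2) * (((1 - t) * a + t * b) - r))"
    by (simp add: algebra_simps)
  then have T: "(1 - t) * ?T a + t * ?T b = r * exp (c * r\<^sup>2)"
    by (simp add: r_def)
  show "r * exp (c * r\<^sup>2) \<le> (1 - t) * (a * exp (c * a\<^sup>2)) + t * (b * exp (c * b\<^sup>2))"
    unfolding T[symmetric]
    using assms r by (intro add_mono mult_left_mono mult_exp_square_tangent(1)) auto
  assume "c > 0" "a \<noteq> b"
  moreover have "a - r = t * (a - b)" "b - r = (1 - t) * (b - a)"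
    by (simp_all add: r_def algebra_simps)
  ultimately have "a \<noteq> r" "b \<noteq> r" using assms(4,5) by auto
  with \<open>c > 0\<close> show "r * exp (c * r\<^sup>2) < (1 - t) * (a * exp (c * a\<^sup>2)) + t * (b * exp (c * b\<^sup>2))"
    unfolding T[symmetric]
    using assms r by (intro add_strict_mono mult_strict_left_mono mult_exp_square_tangent(2)) auto
qed

text \<open>The pointwise inequality is integrated over the unit ball with
  \<open>c = (1 - (norm x)\<^sup>2) / 2\<close>. On the sphere \<open>c = 0\<close> and the
  integrand is linear in the radius, so strictness comes from the open ball, which has positive
  volume.\<close>

lemma gaussian_ratio_cball_strictly_convex:
  fixes a b t :: real
  assumes "a > 0" "b > 0" "a \<noteq> b" "0 < t" "t < 1"
  shows "gaussian_ratio (cball (0 :: real ^ 'n) ((1 - t) * a + t * b))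
    < (1 - t) * gaussian_ratio (cball (0 :: real ^ 'n) a) + t * gaussian_ratio (cball (0 :: real ^ 'n) b)"
proof -
  define h where "h r x = r * exp ((1 - (norm x)\<^sup>2) / 2 * r\<^sup>2)" for r and x :: "real ^ 'n"
  define N where "N = unit_ball_vol (real CARD('n)) * real CARD('n)"
  let ?r = "(1 - t) * a + t * b"
  let ?J = "\<lambda>r. LINT x:cball (0 :: real ^ 'n) 1|lborel. h r x"
  have r: "?r > 0" using assms by (simp add: add_pos_pos)
  have N: "N > 0" unfolding N_def by (intro mult_pos_pos unit_ball_vol_pos) auto
  have int: "set_integrable lborel (cball 0 1) (h r)" for r
    unfolding h_def by (intro set_integrable_continuous_compact continuous_intros compact_cball) auto
  have int': "set_integrable lborel (cball 0 1) (\<lambda>x. (1 - t) * h a x + t * h b x)"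
    by (intro set_integral_add(1) set_integrable_mult_right int)
  have ratio: "gaussian_ratio (cball (0 :: real ^ 'n) r) = ?J r / N" if "r > 0" for r
    using gaussian_ratio_cball[OF that, where 'n='n] by (simp add: h_def N_def)
  have "?J ?r < (LINT x:cball (0 :: real ^ 'n) 1|lborel. (1 - t) * h a x + t * h b x)"
  proof (rule set_integral_less[OF int int'])
    show "emeasure lborel (ball (0 :: real ^ 'n) 1) \<noteq> 0"
      by (simp add: emeasure_ball unit_ball_vol_pos[THEN order_less_imp_not_eq2])
    show "h ?r x \<le> (1 - t) * h a x + t * h b x" if "x \<in> cball 0 1" for x
      unfolding h_def using that assms
      by (intro mult_exp_square_convex(1)) (auto simp: power_le_one)
    show "h ?r x < (1 - t) * h a x + t * h b x" if "x \<in> ball 0 1" for x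
    proof -
      have "(norm x)\<^sup>2 < 1" using that by (simp add: power_less_one_iff)
      then show ?thesis
        unfolding h_def using assms by (intro mult_exp_square_convex(2)) auto
    qed
  qed auto
  also have "\<dots> = (1 - t) * ?J a + t * ?J b"
    by (subst set_integral_add(2)) (auto intro!: set_integrable_mult_right int)
  finally have "?J ?r / N < ((1 - t) * ?J a + t * ?J b) / N"
    using N by (rule divide_strict_right_mono)
  then show ?thesis
    by (simp only: ratio assms r add_divide_distrib times_divide_eq_right)
qed

theorem theorem4p1:
  fixes a t :: real
  assumes "a > 0" and "a \<noteq> 1" and "0 < t" and "t < 1"
  shows "\<not> (gaussian_ratio (dilate ((1 - t) * a) (unit_ball :: (real ^ 'n) set) + dilate t unit_ball)
            \<ge> (1 - t) * gaussian_ratio (dilate a (unit_ball :: (real ^ 'n) set)) + t * gaussian_ratio (unit_ball :: (real ^ 'n) set))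
       \<and> gaussian_ratio (dilate ((1 - t) * a) (unit_ball :: (real ^ 'n) set) + dilate t unit_ball)
            < (1 - t) * gaussian_ratio (dilate a (unit_ball :: (real ^ 'n) set)) + t * gaussian_ratio (unit_ball :: (real ^ 'n) set)"
proof -
  \<comment> \<open>Writing \<open>t * 1\<close> keeps the radius in the form of a convex
    combination of \<open>a\<close> and \<open>1\<close>, so strict convexity applies with
    \<open>b = 1\<close>; both conjuncts express that one strict inequality.\<close>
  have "dilate ((1 - t) * a) (unit_ball :: (real ^ 'n) set) + dilate t unit_ball
      = cball 0 ((1 - t) * a + t * 1)"
    using assms by (simp add: dilate_unit_ball cball_plus_cball)
  moreover have "dilate a (unit_ball :: (real ^ 'n) set) = cball 0 a"
    using assms by (simp add: dilate_unit_ball)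
  ultimately show ?thesis
    using gaussian_ratio_cball_strictly_convex[of a 1 t, where 'n='n] assms by simp
qed

end
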